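(* Let $n,N\ge 1$ be integers, let $\boldsymbol\alpha,\boldsymbol\beta$ satisfy $0<\alpha_k,\beta_k<1$ for $k=1,\dots,n$ and $0<|\beta|<1$, with the $\alpha_k$ pairwise distinct, and let $i\in\{1,2\}$ be a type. Let $\lambda_1,\dots,\lambda_n$ be the roots of $\det(\lambda I_n-F^{(i)})=0$, and let $\boldsymbol u=(u_{kj})$ be the type-$i$ parameters and $\boldsymbol\eta$ the type-$i$ reversible probabilities (all defined in the context). Then for every $\boldsymbol m\in\mathcal X$ the polynomial $P_{\boldsymbol m}(\cdot\,;\boldsymbol u)$ is a left eigenvector of $K_n^{(i)}$ with multiplicative eigenvalue: $$\sum_{\boldsymbol x\in\mathcal X}K_n^{(i)}(\boldsymbol x,\boldsymbol y;N,\boldsymbol\alpha,\boldsymbol\beta)\,P_{\boldsymbol m}(\boldsymbol x;\boldsymbol u)=P_{\boldsymbol m}(\boldsymbol y;\boldsymbol u)\prod_{j=1}^n\lambda_j^{m_j}\qquad\text{for all }\boldsymbol y\in\mathcal X,$$ and likewise $P_{\boldsymbol m}(\cdot\,;\boldsymbol u)W_n(\cdot\,;N,\boldsymbol\eta)$ is an eigenvector of $K_n^{(i)}$ with the same eigenvalue: $$\sum_{\boldsymbol y\in\mathcal X}K_n^{(i)}(\boldsymbol x,\boldsymbol y;N,\boldsymbol\alpha,\boldsymbol\beta)\,P_{\boldsymbol m}(\boldsymbol y;\boldsymbol u)W_n(\boldsymbol y;N,\boldsymbol\eta)=\Bigl(\prod_{j=1}^n\lambda_j^{m_j}\Bigr)P_{\boldsymbol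 m}(\boldsymbol x;\boldsymbol u)W_n(\boldsymbol x;N,\boldsymbol\eta)\qquad\text{for all }\boldsymbol x\in\mathcal X.$$
   Context: Notation: for $\boldsymbol x=(x_1,\dots,x_n)$, $|x|=\sum_{k=1}^n x_k$ (similarly $|\beta|=\sum_k\beta_k$). $\mathcal X=\{\boldsymbol x\in\mathbb N_0^n: |x|\le N\}$. The convention $0^0=1$ is used. Distributions: $W_1(x;y,\alpha)=\binom{y}{x}\alpha^x(1-\alpha)^{y-x}$ for integers $0\le x\le y$, and $0$ otherwise. For an integer $M\ge0$, $$W_n(\boldsymbol x;M,\boldsymbol\beta)=\frac{M!}{x_1!\cdots x_n!\,(M-|x|)!}\,(1-|\beta|)^{M-|x|}\prod_{k=1}^n\beta_k^{x_k}$$ if all $x_k\ge0$ and $|x|\le M$, and $0$ otherwise. Markov chain operators (transition from $\boldsymbol y$ to $\boldsymbol x$, $\boldsymbol x,\boldsymbol y\in\mathcal X$): $$K_n^{(1)}(\boldsymbol x,\boldsymbol y;N,\boldsymbol\alpha,\boldsymbol\beta)=\sum_{\boldsymbol z\in\mathcal X}W_n(\boldsymbol x-\boldsymbol z;N-|z|,\boldsymbol\beta)\prod_{k=1}^nW_1(z_k;y_k,\alpha_k),$$ $$K_n^{(2)}(\boldsymbol x,\boldsymbol y;N,\boldsymbol\alpha,\boldsymbol\beta)=\sum_{\boldsymbol z\in\mathcal X}W_n(\boldsymbol x-\boldsymbol z;N-|y|,\boldsymbol\beta)\prod_{k=1}^nW_1(z_k;y_k,\alpha_k).$$ Characteristic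 matrices ($k,j=1,\dots,n$): $F^{(1)}_{kj}=-\alpha_k\beta_j+\alpha_k\delta_{kj}$ and $F^{(2)}_{kj}=-\beta_j+\alpha_k\delta_{kj}$. The $n$ roots $\lambda_1,\dots,\lambda_n$ of $\det(\lambda I_n-F^{(i)})=0$ are listed with multiplicity in some fixed order. System parameters: for type 1, $u_{kj}=\dfrac{\alpha_k(\lambda_j-1)}{\lambda_j-\alpha_k}$; for type 2, $u_{kj}=\dfrac{\lambda_j-1}{\lambda_j-\alpha_k}$ (with $\lambda_j$ the roots for the corresponding type). Reversible probabilities: $\eta_k=\dfrac{\beta_k}{1-\alpha_k}\dfrac1{D_n}$, where $D_n=1+\sum_{l=1}^n\dfrac{\alpha_l\beta_l}{1-\alpha_l}$ for type 1 and $D_n=1+\sum_{l=1}^n\dfrac{\beta_l}{1-\alpha_l}$ for type 2. $W_n(\cdot\,;N,\boldsymbol\eta)$ is called the reversible distribution: it satisfies $K_n^{(i)}(\boldsymbol x,\boldsymbol y)W_n(\boldsymbol y;N,\boldsymbol\eta)=K_n^{(i)}(\boldsymbol y,\boldsymbol x)W_n(\boldsymbol x;N,\boldsymbol\eta)$. Polynomials: for $\boldsymbol m,\boldsymbol x\in\mathcal X$ and an $n\times n$ matrix $\boldsymbol u=(u_{kj})$, $$P_{\boldsymbol m}(\boldsymbol x;\boldsymbol u)=\sum_{\substack{(c_{kj})\in M_n(\mathbb N_0)\\ \sum_{k,j}c_{kj}\le N}}\frac{\prod_{k=1}^n(-x_k)_{\sum_{j}c_{kj}}\ \prod_{j=1}^n(-m_j)_{\sum_{k}c_{kj}}}{(-N)_{\sum_{k,j}c_{kj}}}\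 \frac{\prod_{k,j}u_{kj}^{c_{kj}}}{\prod_{k,j}c_{kj}!},$$ where $M_n(\mathbb N_0)$ is the set of $n\times n$ matrices with nonnegative integer entries and $(a)_0=1$, $(a)_r=\prod_{s=0}^{r-1}(a+s)$. *)

theory Defs
  imports "HOL-Analysis.Analysis" "HOL-Computational_Algebra.Polynomial"
begin

text \<open>
  The index set \<open>{1, \<dots>, n}\<close> is the finite index type \<open>'n\<close>; vectors indexed by it are functions
  on \<open>'n\<close>. The convention \<open>0 ^ 0 = 1\<close> is the one built into HOL.
\<close>

definition states :: "nat \<Rightarrow> ('n::finite \<Rightarrow> nat) set" where
  "states N = {x. (\<Sum>k\<in>UNIV. x k) \<le> N}"

definition index_matrices :: "nat \<Rightarrow> ('n::finite \<Rightarrow> 'n \<Rightarrow> nat) set" where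
  "index_matrices N = {c. (\<Sum>k\<in>UNIV. \<Sum>j\<in>UNIV. c k j) \<le> N}"

lemma finite_states [simp, intro]: "finite (states N :: ('n::finite \<Rightarrow> nat) set)"
proof (rule finite_subset)
  show "states N \<subseteq> PiE (UNIV :: 'n set) (\<lambda>_. {..N})"
  proof
    fix x :: "'n \<Rightarrow> nat" assume "x \<in> states N"
    moreover have "x k \<le> (\<Sum>k\<in>UNIV. x k)" for k
      by (rule member_le_sum) simp_all
    ultimately show "x \<in> PiE UNIV (\<lambda>_. {..N})"
      unfolding states_def PiE_UNIV_domain Pi_iff by (metis atMost_iff mem_Collect_eq order_trans)
  qed
qed (simp add: finite_PiE)

lemma finite_index_matrices [simp, intro]:
  "finite (index_matrices N :: ('n::finite \<Rightarrow> 'n \<Rightarrow> nat) set)"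
proof (rule finite_subset)
  show "index_matrices N \<subseteq> PiE (UNIV :: 'n set) (\<lambda>_. states N)"
  proof
    fix c :: "'n \<Rightarrow> 'n \<Rightarrow> nat" assume "c \<in> index_matrices N"
    moreover have "(\<Sum>j\<in>UNIV. c k j) \<le> (\<Sum>k\<in>UNIV. \<Sum>j\<in>UNIV. c k j)" for k
      by (rule member_le_sum) simp_all
    ultimately show "c \<in> PiE UNIV (\<lambda>_. states N)"
      unfolding states_def index_matrices_def PiE_UNIV_domain Pi_iff
      by (metis mem_Collect_eq order_trans)
  qed
qed (simp add: finite_PiE)

definition W1 :: "nat \<Rightarrow> nat \<Rightarrow> real \<Rightarrow> real" where
  "W1 x y a = (if x \<le> y then real (y choose x) * a ^ x * (1 - a) ^ (y - x) else 0)"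

text \<open>
  The argument is integer valued because \<open>Wn\<close> is evaluated at differences \<open>x - z\<close>, where it must
  vanish as soon as one component is negative; subtraction on \<open>nat\<close> would truncate instead.
\<close>

definition Wn :: "('n::finite \<Rightarrow> int) \<Rightarrow> nat \<Rightarrow> ('n \<Rightarrow> real) \<Rightarrow> real" where
  "Wn x M \<beta> =
    (if (\<forall>k. 0 \<le> x k) \<and> (\<Sum>k\<in>UNIV. x k) \<le> int M
     then fact M / ((\<Prod>k\<in>UNIV. fact (nat (x k))) * fact (M - (\<Sum>k\<in>UNIV. nat (x k))))
          * (1 - (\<Sum>k\<in>UNIV. \<beta> k)) ^ (M - (\<Sum>k\<in>UNIV. nat (x k)))
          * (\<Prod>k\<in>UNIV. \<beta> k ^ nat (x k))
     else 0)"

datatype chain_type = Type1 | Type2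

text \<open>
  \<open>K i x y N \<alpha> \<beta>\<close> is the probability of the transition from \<open>y\<close> to \<open>x\<close>. The differences
  \<open>N - |z|\<close> and \<open>N - |y|\<close> do not truncate for \<open>y\<close>, \<open>z\<close> in \<open>states N\<close>.
\<close>

fun K :: "chain_type \<Rightarrow> ('n::finite \<Rightarrow> nat) \<Rightarrow> ('n \<Rightarrow> nat) \<Rightarrow> nat \<Rightarrow> ('n \<Rightarrow> real) \<Rightarrow> ('n \<Rightarrow> real) \<Rightarrow> real"
where
  "K Type1 x y N \<alpha> \<beta> =
    (\<Sum>z\<in>states N. Wn (\<lambda>k. int (x k) - int (z k)) (N - (\<Sum>k\<in>UNIV. z k)) \<beta>
                    * (\<Prod>k\<in>UNIV. W1 (z k) (y k) (\<alpha> k)))"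
| "K Type2 x y N \<alpha> \<beta> =
    (\<Sum>z\<in>states N. Wn (\<lambda>k. int (x k) - int (z k)) (N - (\<Sum>k\<in>UNIV. y k)) \<beta>
                    * (\<Prod>k\<in>UNIV. W1 (z k) (y k) (\<alpha> k)))"

fun F :: "chain_type \<Rightarrow> ('n::finite \<Rightarrow> real) \<Rightarrow> ('n \<Rightarrow> real) \<Rightarrow> real^'n^'n" where
  "F Type1 \<alpha> \<beta> = (\<chi> k j. - \<alpha> k * \<beta> j + (if k = j then \<alpha> k else 0))"
| "F Type2 \<alpha> \<beta> = (\<chi> k j. - \<beta> j + (if k = j then \<alpha> k else 0))"

text \<open>The polynomial \<open>det (\<lambda> I - A)\<close> in the indeterminate \<open>\<lambda>\<close>, with complex coefficients.\<close>

definition charpoly :: "real^'n^'n \<Rightarrow> complex poly" where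
  "charpoly A = det (mat [:0, 1:] - (\<chi> k j. [:complex_of_real (A $ k $ j):]) :: complex poly^'n^'n)"

text \<open>
  \<open>lists_roots r p\<close>: the family \<open>r\<close> enumerates the complex roots of \<open>p\<close> with multiplicity, in some
  order.
\<close>

definition lists_roots :: "('n::finite \<Rightarrow> complex) \<Rightarrow> complex poly \<Rightarrow> bool" where
  "lists_roots r p \<longleftrightarrow> image_mset r (mset_set UNIV) = proots p"

text \<open>\<open>u i \<alpha> r k j\<close> is the entry in row \<open>k\<close> and column \<open>j\<close>.\<close>

fun u :: "chain_type \<Rightarrow> ('n::finite \<Rightarrow> real) \<Rightarrow> ('n \<Rightarrow> complex) \<Rightarrow> 'n \<Rightarrow> 'n \<Rightarrow> complex" where
  "u Type1 \<alpha> r k j = of_real (\<alpha> k) * (r j - 1) / (r j - of_real (\<alpha> k))"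
| "u Type2 \<alpha> r k j = (r j - 1) / (r j - of_real (\<alpha> k))"

fun D :: "chain_type \<Rightarrow> ('n::finite \<Rightarrow> real) \<Rightarrow> ('n \<Rightarrow> real) \<Rightarrow> real" where
  "D Type1 \<alpha> \<beta> = 1 + (\<Sum>l\<in>UNIV. \<alpha> l * \<beta> l / (1 - \<alpha> l))"
| "D Type2 \<alpha> \<beta> = 1 + (\<Sum>l\<in>UNIV. \<beta> l / (1 - \<alpha> l))"

definition \<eta> :: "chain_type \<Rightarrow> ('n::finite \<Rightarrow> real) \<Rightarrow> ('n \<Rightarrow> real) \<Rightarrow> 'n \<Rightarrow> real" where
  "\<eta> i \<alpha> \<beta> k = \<beta> k / (1 - \<alpha> k) * (1 / D i \<alpha> \<beta>)"

definition P :: "nat \<Rightarrow> ('n::finite \<Rightarrow> nat) \<Rightarrow> ('n \<Rightarrow> nat) \<Rightarrow> ('n \<Rightarrow> 'n \<Rightarrow> complex) \<Rightarrow> complex" where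
  "P N m x v =
    (\<Sum>c\<in>index_matrices N.
       (\<Prod>k\<in>UNIV. pochhammer (- of_nat (x k)) (\<Sum>j\<in>UNIV. c k j))
       * (\<Prod>j\<in>UNIV. pochhammer (- of_nat (m j)) (\<Sum>k\<in>UNIV. c k j))
       / pochhammer (- of_nat N) (\<Sum>k\<in>UNIV. \<Sum>j\<in>UNIV. c k j)
       * ((\<Prod>k\<in>UNIV. \<Prod>j\<in>UNIV. v k j ^ c k j) / (\<Prod>k\<in>UNIV. \<Prod>j\<in>UNIV. fact (c k j))))"

end

theory Submission
  imports Defs
begin

text \<open>
  The polynomials have the generating function
  \<open>\<Sum>m. multinom N m * t\<^sup>m * P\<^sub>m(x) = G(x, t) = (1 + |t|)\<^bsup>N - |x|\<^esup> * (\<Prod>k. (1 + (\<Sum>j. (1 - u\<^sub>k\<^sub>j) t\<^sub>j))\<^bsup>x\<^sub>k\<^esup>)\<close>.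
  The kernel maps a power product \<open>s\<^sub>0\<^bsup>N - |x|\<^esup> * (\<Prod>k. s\<^sub>k\<^bsup>x\<^sub>k\<^esup>)\<close> to a product of powers of linear forms in
  \<open>s\<close>, and the equation \<open>(\<Sum>k. \<beta>\<^sub>k w\<^sub>k / (\<lambda>\<^sub>j - \<alpha>\<^sub>k)) = -1\<close> satisfied by the roots (with \<open>w\<^sub>k = \<alpha>\<^sub>k\<close> or \<open>1\<close>,
  according to the type) says precisely that it sends \<open>G(\<cdot>, t)\<close> to \<open>G(y, \<lambda>\<^sub>1 t\<^sub>1, \<dots>, \<lambda>\<^sub>n t\<^sub>n)\<close>. Comparing coefficients
  of \<open>t\<^sup>m\<close> gives the first eigenvalue equation; detailed balance, which holds separately for each
  intermediate state \<open>z\<close> of the kernel, turns it into the second.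
\<close>

section \<open>Multinomial sums\<close>

text \<open>Category 0 is implicit and has size \<open>M - sum z UNIV\<close>. The type is left open
  because \<open>Wn\<close> needs the coefficient over the reals and the generating functions need
  it over the complex numbers.\<close>

definition multinom :: "nat \<Rightarrow> ('n::finite \<Rightarrow> nat) \<Rightarrow> 'a::field_char_0" where
  "multinom M z = fact M / ((\<Prod>k\<in>UNIV. fact (z k)) * fact (M - sum z UNIV))"

lemma multinom_nonzero: "multinom M z \<noteq> (0 :: 'a::field_char_0)"
  by (simp add: multinom_def)

lemma of_real_multinom: "of_real (multinom M z) = (multinom M z :: complex)"
  by (simp add: multinom_def)

text \<open>Induction on \<open>A\<close>: fixing the exponent \<open>d\<close> of
  \<open>b k\<close> splits the coefficient into \<open>M choose d\<close> and a coefficient for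
  \<open>M - d\<close>, and the binomial theorem then merges \<open>b k\<close> into the base.
  Forcing \<open>z\<close> to vanish outside \<open>A\<close> keeps the index set finite.\<close>

lemma multinomial_theorem_on:
  fixes a :: "'a::field_char_0" and b :: "'b \<Rightarrow> 'a"
  assumes "finite A"
  shows "(\<Sum>z | (\<forall>k. k \<notin> A \<longrightarrow> z k = 0) \<and> sum z A \<le> M.
            fact M / ((\<Prod>k\<in>A. fact (z k)) * fact (M - sum z A))
            * (a ^ (M - sum z A) * (\<Prod>k\<in>A. b k ^ z k)))
         = (a + sum b A) ^ M"
  using assms
proof (induction A arbitrary: M rule: finite_induct)
  case empty
  have "{z :: 'b \<Rightarrow> nat. \<forall>k. z k = 0} = {\<lambda>_. 0}" by auto
  then show ?case by simp
next
  case (insert k A)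
  define S where "S B M = {z :: 'b \<Rightarrow> nat. (\<forall>k. k \<notin> B \<longrightarrow> z k = 0) \<and> sum z B \<le> M}" for B M
  define g where "g B M z = fact M / ((\<Prod>k\<in>B. fact (z k)) * fact (M - sum z B))
            * (a ^ (M - sum z B) * (\<Prod>k\<in>B. b k ^ z k))" for B M z
  have fin: "finite (S A M)" for M
  proof -
    have "finite {z. \<forall>k. (k \<in> A \<longrightarrow> z k \<in> {..M}) \<and> (k \<notin> A \<longrightarrow> z k = (0::nat))}"
      by (rule finite_set_of_finite_funs) (use insert in auto)
    moreover have "S A M \<subseteq> {z. \<forall>k. (k \<in> A \<longrightarrow> z k \<in> {..M}) \<and> (k \<notin> A \<longrightarrow> z k = (0::nat))}"
      using insert(1) by (auto simp: S_def intro: order_trans[OF member_le_sum])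
    ultimately show ?thesis by (rule rev_finite_subset)
  qed
  have upd: "sum (z(k := d)) A = sum z A" "(\<Prod>i\<in>A. fact ((z(k := d)) i)) = (\<Prod>i\<in>A. fact (z i) :: 'a)"
    "(\<Prod>i\<in>A. b i ^ ((z(k := d)) i)) = (\<Prod>i\<in>A. b i ^ z i)" for z :: "'b \<Rightarrow> nat" and d
    using insert(2) by (auto intro!: sum.cong prod.cong)
  \<comment> \<open>An exponent vector is traded for its value \<open>d\<close> at \<open>k\<close>
    and the vector with that value reset to 0.\<close>
  have "(\<Sum>z\<in>S (insert k A) M. g (insert k A) M z)
      = (\<Sum>(d, z)\<in>Sigma {..M} (\<lambda>d. S A (M - d)). of_nat (M choose d) * b k ^ d * g A (M - d) z)"
  proof (rule sum.reindex_bij_witness[where i = "\<lambda>(d, z). z(k := d)" and j = "\<lambda>z. (z k, z(k := 0))"])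
    fix z assume z: "z \<in> S (insert k A) M"
    show "(case (z k, z(k := 0)) of (d, z) \<Rightarrow> z(k := d)) = z" by auto
    show "(z k, z(k := 0)) \<in> Sigma {..M} (\<lambda>d. S A (M - d))"
      using z insert upd(1)[of z 0] by (auto simp: S_def)
    have le: "z k \<le> M" using z insert(1,2) by (auto simp: S_def)
    have "M - z k - sum z A = M - (z k + sum z A)" by simp
    then show "(case (z k, z(k := 0)) of (d, z) \<Rightarrow> of_nat (M choose d) * b k ^ d * g A (M - d) z)
        = g (insert k A) M z"
      using le insert(1,2) by (simp add: g_def upd binomial_fact mult_ac del: fun_upd_apply)
  next
    fix p assume p: "p \<in> Sigma {..M} (\<lambda>d. S A (M - d))"
    then obtain d z where dz: "p = (d, z)" "d \<le> M" "z \<in> S A (M - d)" by auto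
    have [simp]: "z k = 0" using dz(3) insert(2) by (auto simp: S_def)
    show "((case p of (d, z) \<Rightarrow> z(k := d)) k, (case p of (d, z) \<Rightarrow> z(k := d))(k := 0)) = p"
      by (auto simp: dz)
    show "(case p of (d, z) \<Rightarrow> z(k := d)) \<in> S (insert k A) M"
      using dz insert(1,2) upd(1)[of z d] by (auto simp: S_def)
  qed
  also have "\<dots> = (\<Sum>d\<le>M. \<Sum>z\<in>S A (M - d). of_nat (M choose d) * b k ^ d * g A (M - d) z)"
    by (subst sum.Sigma) (auto simp: fin)
  also have "\<dots> = (\<Sum>d\<le>M. of_nat (M choose d) * b k ^ d * (a + sum b A) ^ (M - d))"
    by (simp only: sum_distrib_left[symmetric] g_def S_def insert.IH)
  also have "\<dots> = (b k + (a + sum b A)) ^ M" by (simp add: binomial_ring)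
  finally show ?case using insert(1,2) by (simp add: g_def S_def add_ac)
qed

lemma multinomial_theorem:
  fixes a :: "'a::field_char_0" and b :: "'n::finite \<Rightarrow> 'a"
  shows "(\<Sum>z\<in>states M. multinom M z * (a ^ (M - sum z UNIV) * (\<Prod>k\<in>UNIV. b k ^ z k)))
    = (a + sum b UNIV) ^ M"
  using multinomial_theorem_on[of UNIV M a b] by (simp add: multinom_def states_def)

section \<open>The action of the transition kernel on power products\<close>

text \<open>Once \<open>z\<close> lies below \<open>x\<close> componentwise, subtraction on
  \<open>nat\<close> is exact, so the integer guard of \<open>Wn\<close> becomes one on natural
  numbers, which is the form needed for reindexing sums.\<close>

lemma Wn_diff:
  fixes x z :: "'n::finite \<Rightarrow> nat"
  shows "Wn (\<lambda>k. int (x k) - int (z k)) M \<beta> =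
    (if (\<forall>k. z k \<le> x k) \<and> (\<Sum>k\<in>UNIV. x k - z k) \<le> M
     then multinom M (\<lambda>k. x k - z k)
          * ((1 - sum \<beta> UNIV) ^ (M - (\<Sum>k\<in>UNIV. x k - z k)) * (\<Prod>k\<in>UNIV. \<beta> k ^ (x k - z k)))
     else 0)"
proof (cases "\<forall>k. z k \<le> x k")
  case True
  have [simp]: "nat (int (x k) - int (z k)) = x k - z k" for k by simp
  have "(\<Sum>k\<in>UNIV. int (x k) - int (z k)) = int (\<Sum>k\<in>UNIV. x k - z k)"
    using True by (simp add: of_nat_diff)
  then have "((\<Sum>k\<in>UNIV. int (x k) - int (z k)) \<le> int M) \<longleftrightarrow> (\<Sum>k\<in>UNIV. x k - z k) \<le> M" by linarith
  then show ?thesis using True by (simp add: Wn_def multinom_def mult_ac)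
next
  case False
  then have "\<not> (\<forall>k. 0 \<le> int (x k) - int (z k))" by auto
  with False show ?thesis unfolding Wn_def by (simp only: if_False simp_thms)
qed

lemma Wn_nat:
  fixes x :: "'n::finite \<Rightarrow> nat"
  shows "Wn (\<lambda>k. int (x k)) M \<beta> =
    (if sum x UNIV \<le> M
     then multinom M x * ((1 - sum \<beta> UNIV) ^ (M - sum x UNIV) * (\<Prod>k\<in>UNIV. \<beta> k ^ x k))
     else 0)"
  using Wn_diff[of x "\<lambda>_. 0" M \<beta>] by simp

lemma sum_diff_nat_fun:
  fixes x z :: "'n::finite \<Rightarrow> nat"
  assumes "\<And>k. z k \<le> x k"
  shows "(\<Sum>k\<in>UNIV. x k - z k) = sum x UNIV - sum z UNIV" "sum z UNIV \<le> sum x UNIV"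
  using assms by (auto simp: sum_subtractf_nat intro: sum_mono)

text \<open>The substitution \<open>x = z + w\<close> reduces this to the multinomial theorem. Of
  the \<open>N\<close> individuals, \<open>M\<close> are redistributed, those counted by
  \<open>z\<close> stay put, and the other \<open>N - |z| - M\<close> remain in category 0 with
  weight \<open>s0\<close>.\<close>

lemma Wn_transform:
  fixes z :: "'n::finite \<Rightarrow> nat" and s :: "'n \<Rightarrow> complex"
  assumes "sum z UNIV + M \<le> N"
  shows "(\<Sum>x\<in>states N. of_real (Wn (\<lambda>k. int (x k) - int (z k)) M \<beta>)
            * (s0 ^ (N - sum x UNIV) * (\<Prod>k\<in>UNIV. s k ^ x k)))
    = s0 ^ (N - sum z UNIV - M)
      * (of_real (1 - sum \<beta> UNIV) * s0 + (\<Sum>k\<in>UNIV. of_real (\<beta> k) * s k)) ^ M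
      * (\<Prod>k\<in>UNIV. s k ^ z k)" (is "?lhs = ?rhs")
proof -
  define B where "B = {x \<in> states N. (\<forall>k. z k \<le> x k) \<and> (\<Sum>k\<in>UNIV. x k - z k) \<le> M}"
  have "?lhs = (\<Sum>x\<in>B. of_real (Wn (\<lambda>k. int (x k) - int (z k)) M \<beta>)
            * (s0 ^ (N - sum x UNIV) * (\<Prod>k\<in>UNIV. s k ^ x k)))"
    by (rule sum.mono_neutral_right) (auto simp: B_def Wn_diff)
  also have "\<dots> = (\<Sum>w\<in>states M. s0 ^ (N - sum z UNIV - M) * (\<Prod>k\<in>UNIV. s k ^ z k)
      * (multinom M w * ((of_real (1 - sum \<beta> UNIV) * s0) ^ (M - sum w UNIV)
        * (\<Prod>k\<in>UNIV. (of_real (\<beta> k) * s k) ^ w k))))"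
  proof (rule sum.reindex_bij_witness[where i = "\<lambda>w k. z k + w k" and j = "\<lambda>x k. x k - z k"])
    fix x assume x: "x \<in> B"
    then have le: "\<And>k. z k \<le> x k" by (auto simp: B_def)
    show "(\<lambda>k. z k + (x k - z k)) = x" using le by auto
    show "(\<lambda>k. x k - z k) \<in> states M" using x by (auto simp: B_def states_def)
    have "sum x UNIV - sum z UNIV \<le> M" "sum z UNIV \<le> sum x UNIV" "sum x UNIV \<le> N"
      using x sum_diff_nat_fun[of z x, OF le] by (auto simp: B_def states_def)
    then have "N - sum z UNIV - M + (M - (sum x UNIV - sum z UNIV)) = N - sum x UNIV"
      using assms by linarith
    then have s0: "s0 ^ (N - sum x UNIV) = s0 ^ (N - sum z UNIV - M) * s0 ^ (M - (sum x UNIV - sum z UNIV))"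
      by (metis power_add)
    have s: "(\<Prod>k\<in>UNIV. s k ^ x k) = (\<Prod>k\<in>UNIV. s k ^ z k) * (\<Prod>k\<in>UNIV. s k ^ (x k - z k))"
      using le by (simp add: prod.distrib[symmetric] power_add[symmetric])
    show "s0 ^ (N - sum z UNIV - M) * (\<Prod>k\<in>UNIV. s k ^ z k)
      * (multinom M (\<lambda>k. x k - z k) * ((of_real (1 - sum \<beta> UNIV) * s0) ^ (M - (\<Sum>k\<in>UNIV. x k - z k))
        * (\<Prod>k\<in>UNIV. (of_real (\<beta> k) * s k) ^ (x k - z k))))
      = of_real (Wn (\<lambda>k. int (x k) - int (z k)) M \<beta>)
            * (s0 ^ (N - sum x UNIV) * (\<Prod>k\<in>UNIV. s k ^ x k))"
      using x le unfolding Wn_diff s0 s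
      by (simp add: B_def of_real_multinom sum_diff_nat_fun(1)[of z, OF le] power_mult_distrib prod.distrib)
  next
    fix w :: "'n \<Rightarrow> nat" assume "w \<in> states M"
    then show "(\<lambda>k. z k + w k) \<in> B" using assms by (auto simp: B_def states_def sum.distrib)
  qed auto
  also have "\<dots> = ?rhs"
    by (simp add: sum_distrib_left[symmetric] multinomial_theorem)
  finally show ?thesis .
qed

text \<open>The components are thinned independently, so the sum factorises into binomial theorems.
  The weight \<open>c\<close> is carried by each individual lost in the thinning.\<close>

lemma W1_transform:
  fixes y :: "'n::finite \<Rightarrow> nat" and s :: "'n \<Rightarrow> complex"
  assumes "y \<in> states N"
  shows "(\<Sum>z\<in>states N. of_real (\<Prod>k\<in>UNIV. W1 (z k) (y k) (\<alpha> k))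
            * ((\<Prod>k\<in>UNIV. s k ^ z k) * c ^ (sum y UNIV - sum z UNIV)))
    = (\<Prod>k\<in>UNIV. (of_real (\<alpha> k) * s k + of_real (1 - \<alpha> k) * c) ^ y k)" (is "?lhs = ?rhs")
proof -
  define B where "B = PiE UNIV (\<lambda>k. {..y k})"
  have "?lhs = (\<Sum>z\<in>B. of_real (\<Prod>k\<in>UNIV. W1 (z k) (y k) (\<alpha> k))
            * ((\<Prod>k\<in>UNIV. s k ^ z k) * c ^ (sum y UNIV - sum z UNIV)))"
  proof (rule sum.mono_neutral_right)
    show "B \<subseteq> states N"
      using assms by (auto simp: B_def states_def PiE_UNIV_domain intro: order_trans[OF sum_mono])
    show "\<forall>z\<in>states N - B. of_real (\<Prod>k\<in>UNIV. W1 (z k) (y k) (\<alpha> k))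
            * ((\<Prod>k\<in>UNIV. s k ^ z k) * c ^ (sum y UNIV - sum z UNIV)) = 0"
      by (auto simp: B_def W1_def)
  qed auto
  also have "\<dots> = (\<Sum>z\<in>B. \<Prod>k\<in>UNIV. of_nat (y k choose z k) * (of_real (\<alpha> k) * s k) ^ z k
            * (of_real (1 - \<alpha> k) * c) ^ (y k - z k))"
  proof (rule sum.cong)
    fix z assume "z \<in> B"
    then have le: "\<And>k. z k \<le> y k" by (auto simp: B_def)
    show "of_real (\<Prod>k\<in>UNIV. W1 (z k) (y k) (\<alpha> k))
            * ((\<Prod>k\<in>UNIV. s k ^ z k) * c ^ (sum y UNIV - sum z UNIV))
      = (\<Prod>k\<in>UNIV. of_nat (y k choose z k) * (of_real (\<alpha> k) * s k) ^ z k
            * (of_real (1 - \<alpha> k) * c) ^ (y k - z k))"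
      using le by (simp add: W1_def prod.distrib power_mult_distrib sum_diff_nat_fun(1)[of z, OF le, symmetric] power_sum
         del: of_real_diff)
  qed simp
  also have "\<dots> = ?rhs"
    unfolding B_def by (subst prod_sum_PiE[symmetric]) (auto simp: binomial_ring simp del: of_real_diff)
  finally show ?thesis .
qed

lemma prod_W1_eq_0: "\<not> (\<forall>k. z k \<le> y k) \<Longrightarrow> (\<Prod>k\<in>UNIV. W1 (z k) (y k) (\<alpha> (k :: 'n::finite))) = 0"
  by (auto simp: W1_def intro: prod_zero)

text \<open>For fixed \<open>z\<close> the sum over \<open>x\<close> is \<open>Wn_transform\<close>;
  the sum over \<open>z\<close> is then \<open>W1_transform\<close>. Individuals lost from
  \<open>y\<close> are redistributed in type 1, which gives them weight \<open>b\<close>, and go to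
  category 0 in type 2, with weight \<open>s0\<close>.\<close>

lemma K_transform:
  fixes y :: "'n::finite \<Rightarrow> nat" and s :: "'n \<Rightarrow> complex" and s0 :: complex and \<alpha> \<beta> :: "'n \<Rightarrow> real"
  assumes "y \<in> states N"
  defines "b \<equiv> of_real (1 - sum \<beta> UNIV) * s0 + (\<Sum>k\<in>UNIV. of_real (\<beta> k) * s k)"
  shows "(\<Sum>x\<in>states N. of_real (K i x y N \<alpha> \<beta>)
            * (s0 ^ (N - sum x UNIV) * (\<Prod>k\<in>UNIV. s k ^ x k)))
    = b ^ (N - sum y UNIV)
      * (\<Prod>k\<in>UNIV. (of_real (\<alpha> k) * s k
          + of_real (1 - \<alpha> k) * (case i of Type1 \<Rightarrow> b | Type2 \<Rightarrow> s0)) ^ y k)"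
proof -
  define M where "M z = (case i of Type1 \<Rightarrow> N - sum z UNIV | Type2 \<Rightarrow> N - sum y UNIV)" for z :: "'n \<Rightarrow> nat"
  define c where "c = (case i of Type1 \<Rightarrow> b | Type2 \<Rightarrow> s0)"
  have K: "K i x y N \<alpha> \<beta> = (\<Sum>z\<in>states N. Wn (\<lambda>k. int (x k) - int (z k)) (M z) \<beta>
                    * (\<Prod>k\<in>UNIV. W1 (z k) (y k) (\<alpha> k)))" for x
    by (cases i) (simp_all add: M_def)
  have inner: "of_real (\<Prod>k\<in>UNIV. W1 (z k) (y k) (\<alpha> k))
      * (\<Sum>x\<in>states N. of_real (Wn (\<lambda>k. int (x k) - int (z k)) (M z) \<beta>)
            * (s0 ^ (N - sum x UNIV) * (\<Prod>k\<in>UNIV. s k ^ x k)))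
      = b ^ (N - sum y UNIV) * (of_real (\<Prod>k\<in>UNIV. W1 (z k) (y k) (\<alpha> k))
            * ((\<Prod>k\<in>UNIV. s k ^ z k) * c ^ (sum y UNIV - sum z UNIV)))"
    if z: "z \<in> states N" for z
  \<comment> \<open>The exponents can be matched only without truncation; for all other
    \<open>z\<close> both sides vanish.\<close>
  proof (cases "\<forall>k. z k \<le> y k")
    case True
    then have le: "sum z UNIV \<le> sum y UNIV" "sum y UNIV \<le> N"
      using assms(1) by (auto simp: states_def intro: sum_mono)
    have M: "sum z UNIV + M z \<le> N" using le by (cases i) (simp_all add: M_def)
    have "s0 ^ (N - sum z UNIV - M z) * b ^ M z = b ^ (N - sum y UNIV) * c ^ (sum y UNIV - sum z UNIV)"
      using le by (cases i) (simp_all add: M_def c_def power_add[symmetric])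
    then show ?thesis unfolding Wn_transform[OF M] b_def[symmetric] by (simp only: ac_simps)
  next
    case False
    then show ?thesis by (simp add: prod_W1_eq_0)
  qed
  have "(\<Sum>x\<in>states N. of_real (K i x y N \<alpha> \<beta>)
            * (s0 ^ (N - sum x UNIV) * (\<Prod>k\<in>UNIV. s k ^ x k)))
      = (\<Sum>x\<in>states N. \<Sum>z\<in>states N. of_real (\<Prod>k\<in>UNIV. W1 (z k) (y k) (\<alpha> k))
          * (of_real (Wn (\<lambda>k. int (x k) - int (z k)) (M z) \<beta>)
            * (s0 ^ (N - sum x UNIV) * (\<Prod>k\<in>UNIV. s k ^ x k))))"
    unfolding K of_real_sum sum_distrib_right of_real_mult by (simp only: mult_ac)
  also have "\<dots> = (\<Sum>z\<in>states N. of_real (\<Prod>k\<in>UNIV. W1 (z k) (y k) (\<alpha> k))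
      * (\<Sum>x\<in>states N. of_real (Wn (\<lambda>k. int (x k) - int (z k)) (M z) \<beta>)
            * (s0 ^ (N - sum x UNIV) * (\<Prod>k\<in>UNIV. s k ^ x k))))"
    by (subst sum.swap) (simp only: sum_distrib_left)
  also have "\<dots> = b ^ (N - sum y UNIV) * (\<Prod>k\<in>UNIV. (of_real (\<alpha> k) * s k + of_real (1 - \<alpha> k) * c) ^ y k)"
    by (simp only: inner sum_distrib_left[symmetric] W1_transform[OF assms(1)] cong: sum.cong)
  finally show ?thesis by (simp only: c_def)
qed

section \<open>The generating function of the polynomials\<close>

text \<open>The vanishing case is what restricts the sums to row sums at most \<open>x k\<close> and
  column sums at most \<open>m j\<close>.\<close>

lemma pochhammer_minus_nat:
  "pochhammer (- of_nat n) r = (if r \<le> n then (-1) ^ r * fact n / fact (n - r) else (0 :: 'a::field_char_0))"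
proof -
  have "of_nat (n choose r) = (-1) ^ r * pochhammer (- of_nat n) r / (fact r :: 'a)"
    by (simp add: binomial_gbinomial gbinomial_pochhammer)
  then have "pochhammer (- of_nat n) r = (-1) ^ r * fact r * (of_nat (n choose r) :: 'a)"
    by (simp add: mult.left_commute[of "(-1) ^ r"] flip: mult.assoc power_mult_distrib)
  then show ?thesis by (simp add: binomial_fact binomial_eq_0)
qed

text \<open>The Pochhammer factors cancel part of each \<open>fact (m j)\<close>, leaving
  \<open>pochhammer (- of_nat N) (sum d UNIV)\<close> times the multinomial coefficient of
  \<open>m - d\<close>; the signs agree. The first factor will cancel the denominator in
  \<open>P\<close>.\<close>

lemma multinom_pochhammer_sum:
  fixes t :: "'n::finite \<Rightarrow> 'a::field_char_0"
  assumes "d \<in> states N"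
  shows "(\<Sum>m\<in>states N. multinom N m * (\<Prod>j\<in>UNIV. t j ^ m j) * (\<Prod>j\<in>UNIV. pochhammer (- of_nat (m j)) (d j)))
    = pochhammer (- of_nat N) (sum d UNIV) * (\<Prod>j\<in>UNIV. t j ^ d j) * (1 + sum t UNIV) ^ (N - sum d UNIV)"
    (is "?lhs = ?rhs")
proof -
  define B where "B = {m \<in> states N. \<forall>j. d j \<le> m j}"
  have "?lhs = (\<Sum>m\<in>B. multinom N m * (\<Prod>j\<in>UNIV. t j ^ m j) * (\<Prod>j\<in>UNIV. pochhammer (- of_nat (m j)) (d j)))"
    by (rule sum.mono_neutral_right) (auto simp: B_def pochhammer_minus_nat)
  also have "\<dots> = (\<Sum>w\<in>states (N - sum d UNIV). pochhammer (- of_nat N) (sum d UNIV) * (\<Prod>j\<in>UNIV. t j ^ d j)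
      * (multinom (N - sum d UNIV) w * (1 ^ (N - sum d UNIV - sum w UNIV) * (\<Prod>j\<in>UNIV. t j ^ w j))))"
  proof (rule sum.reindex_bij_witness[where i = "\<lambda>w j. d j + w j" and j = "\<lambda>m j. m j - d j"])
    fix m assume m: "m \<in> B"
    then have le: "\<And>j. d j \<le> m j" by (auto simp: B_def)
    have N: "sum d UNIV \<le> sum m UNIV" "sum m UNIV \<le> N"
      using sum_diff_nat_fun[of d m, OF le] m by (auto simp: B_def states_def)
    show "(\<lambda>j. d j + (m j - d j)) = m" using le by auto
    show "(\<lambda>j. m j - d j) \<in> states (N - sum d UNIV)"
      using N by (simp add: states_def sum_diff_nat_fun(1)[of d, OF le])
    have t: "(\<Prod>j\<in>UNIV. t j ^ m j) = (\<Prod>j\<in>UNIV. t j ^ d j) * (\<Prod>j\<in>UNIV. t j ^ (m j - d j))"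
      using le by (simp add: prod.distrib[symmetric] power_add[symmetric])
    have p: "(\<Prod>j\<in>UNIV. pochhammer (- of_nat (m j)) (d j))
        = (-1) ^ sum d UNIV * (\<Prod>j\<in>UNIV. fact (m j)) / (\<Prod>j\<in>UNIV. fact (m j - d j) :: 'a)"
      using le by (simp add: pochhammer_minus_nat prod.distrib prod_dividef power_sum)
    have "N - sum d UNIV - (sum m UNIV - sum d UNIV) = N - sum m UNIV" using N by simp
    then show "pochhammer (- of_nat N) (sum d UNIV) * (\<Prod>j\<in>UNIV. t j ^ d j)
      * (multinom (N - sum d UNIV) (\<lambda>j. m j - d j) * (1 ^ (N - sum d UNIV - (\<Sum>j\<in>UNIV. m j - d j))
          * (\<Prod>j\<in>UNIV. t j ^ (m j - d j))))
      = multinom N m * (\<Prod>j\<in>UNIV. t j ^ m j) * (\<Prod>j\<in>UNIV. pochhammer (- of_nat (m j)) (d j))"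
      using N unfolding t p by (simp add: multinom_def sum_diff_nat_fun(1)[of d, OF le] pochhammer_minus_nat mult_ac)
  next
    fix w :: "'n \<Rightarrow> nat" assume "w \<in> states (N - sum d UNIV)"
    then show "(\<lambda>j. d j + w j) \<in> B" using assms by (auto simp: B_def states_def sum.distrib)
  qed auto
  also have "\<dots> = ?rhs" by (simp only: sum_distrib_left[symmetric] multinomial_theorem)
  finally show ?thesis .
qed

text \<open>Summing over \<open>m\<close> first, with \<open>d\<close> the column sums of
  \<open>c\<close>, removes the denominator. What remains factorises over the rows of
  \<open>c\<close>, and each row sum is a multinomial expansion of \<open>T\<close> minus the sum of
  \<open>v k j * t j\<close>.\<close>

lemma P_generating_function:
  fixes t :: "'n::finite \<Rightarrow> complex"
  assumes "x \<in> states N"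
  shows "(\<Sum>m\<in>states N. multinom N m * (\<Prod>j\<in>UNIV. t j ^ m j) * P N m x v)
    = (1 + sum t UNIV) ^ (N - sum x UNIV) * (\<Prod>k\<in>UNIV. (1 + (\<Sum>j\<in>UNIV. (1 - v k j) * t j)) ^ x k)"
    (is "?lhs = ?rhs")
proof -
  define T where "T = 1 + sum t UNIV"
  define col where "col c j = (\<Sum>k\<in>UNIV. c k j)" for c :: "'n \<Rightarrow> 'n \<Rightarrow> nat" and j
  \<comment> \<open>\<open>h k d\<close> is the share of row \<open>k\<close> when its entries are
    \<open>d\<close>; \<open>rest c\<close> below collects the factors free of \<open>m\<close> and
    \<open>N\<close>.\<close>
  define h where "h k d = pochhammer (- of_nat (x k)) (sum d UNIV)
      * ((\<Prod>j\<in>UNIV. (v k j * t j) ^ d j) / (\<Prod>j\<in>UNIV. fact (d j)) * T ^ (x k - sum d UNIV))" for k and d :: "'n \<Rightarrow> nat"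
  define rest where "rest c = (\<Prod>k\<in>UNIV. pochhammer (- of_nat (x k)) (sum (c k) UNIV))
      * ((\<Prod>k\<in>UNIV. \<Prod>j\<in>UNIV. v k j ^ c k j) / (\<Prod>k\<in>UNIV. \<Prod>j\<in>UNIV. fact (c k j)))" for c :: "'n \<Rightarrow> 'n \<Rightarrow> nat"
  define B where "B = PiE (UNIV :: 'n set) (\<lambda>k. states (x k) :: ('n \<Rightarrow> nat) set)"
  have col: "sum (col c) UNIV = (\<Sum>k\<in>UNIV. sum (c k) UNIV)" for c
    unfolding col_def by (rule sum.swap)
  have row: "(\<Sum>d\<in>states (x k). h k d) = (1 + (\<Sum>j\<in>UNIV. (1 - v k j) * t j)) ^ x k" for k
  proof -
    have "(\<Sum>d\<in>states (x k). h k d)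
      = (\<Sum>d\<in>states (x k). multinom (x k) d * (T ^ (x k - sum d UNIV) * (\<Prod>j\<in>UNIV. (- (v k j * t j)) ^ d j)))"
    proof (rule sum.cong)
      fix d :: "'n \<Rightarrow> nat" assume "d \<in> states (x k)"
      moreover have "(\<Prod>j\<in>UNIV. (- (v k j * t j)) ^ d j) = (-1) ^ sum d UNIV * (\<Prod>j\<in>UNIV. (v k j * t j) ^ d j)"
        by (subst power_minus) (simp add: prod.distrib power_sum)
      ultimately show "h k d = multinom (x k) d * (T ^ (x k - sum d UNIV) * (\<Prod>j\<in>UNIV. (- (v k j * t j)) ^ d j))"
        by (simp add: h_def pochhammer_minus_nat multinom_def states_def mult_ac)
    qed simp
    then show ?thesis unfolding multinomial_theorem
      by (simp add: T_def algebra_simps sum_subtractf sum_negf)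
  qed
  have "?lhs = (\<Sum>c\<in>index_matrices N. rest c / pochhammer (- of_nat N) (sum (col c) UNIV)
      * (\<Sum>m\<in>states N. multinom N m * (\<Prod>j\<in>UNIV. t j ^ m j) * (\<Prod>j\<in>UNIV. pochhammer (- of_nat (m j)) (col c j))))"
    unfolding P_def sum_distrib_left
    by (subst sum.swap) (simp add: rest_def col col_def[symmetric] mult_ac)
  also have "\<dots> = (\<Sum>c\<in>index_matrices N. rest c * (\<Prod>j\<in>UNIV. t j ^ col c j) * T ^ (N - sum (col c) UNIV))"
  proof (rule sum.cong)
    fix c :: "'n \<Rightarrow> 'n \<Rightarrow> nat" assume "c \<in> index_matrices N"
    then have c: "col c \<in> states N" by (simp add: index_matrices_def states_def col)
    then have "pochhammer (- of_nat N) (sum (col c) UNIV) \<noteq> (0 :: complex)"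
      by (simp add: pochhammer_minus_nat states_def)
    then show "rest c / pochhammer (- of_nat N) (sum (col c) UNIV)
      * (\<Sum>m\<in>states N. multinom N m * (\<Prod>j\<in>UNIV. t j ^ m j) * (\<Prod>j\<in>UNIV. pochhammer (- of_nat (m j)) (col c j)))
      = rest c * (\<Prod>j\<in>UNIV. t j ^ col c j) * T ^ (N - sum (col c) UNIV)"
      unfolding multinom_pochhammer_sum[OF c] by (simp add: T_def)
  qed simp
  also have "\<dots> = (\<Sum>c\<in>B. rest c * (\<Prod>j\<in>UNIV. t j ^ col c j) * T ^ (N - sum (col c) UNIV))"
  proof (rule sum.mono_neutral_right)
    show "B \<subseteq> index_matrices N"
      using assms by (auto simp: B_def states_def index_matrices_def PiE_UNIV_domain Pi_iff intro: order_trans[OF sum_mono])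
    show "\<forall>c\<in>index_matrices N - B. rest c * (\<Prod>j\<in>UNIV. t j ^ col c j) * T ^ (N - sum (col c) UNIV) = 0"
      by (auto simp: B_def rest_def states_def pochhammer_minus_nat)
  qed simp
  also have "\<dots> = (\<Sum>c\<in>B. T ^ (N - sum x UNIV) * (\<Prod>k\<in>UNIV. h k (c k)))"
  proof (rule sum.cong)
    fix c assume "c \<in> B"
    then have le: "\<And>k. sum (c k) UNIV \<le> x k" by (auto simp: B_def states_def PiE_UNIV_domain Pi_iff)
    have t: "(\<Prod>j\<in>UNIV. t j ^ col c j) = (\<Prod>k\<in>UNIV. \<Prod>j\<in>UNIV. t j ^ c k j)"
      unfolding col_def power_sum by (rule prod.swap)
    \<comment> \<open>Splitting the exponent into \<open>N - |x|\<close> and the slack of each row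
      distributes the powers of \<open>T\<close> over the rows.\<close>
    have "N - sum (col c) UNIV = (N - sum x UNIV) + (\<Sum>k\<in>UNIV. x k - sum (c k) UNIV)"
      using assms sum_diff_nat_fun[of "\<lambda>k. sum (c k) UNIV" x, OF le] by (simp add: states_def col)
    then have "T ^ (N - sum (col c) UNIV) = T ^ (N - sum x UNIV) * (\<Prod>k\<in>UNIV. T ^ (x k - sum (c k) UNIV))"
      by (simp add: power_add power_sum)
    then show "rest c * (\<Prod>j\<in>UNIV. t j ^ col c j) * T ^ (N - sum (col c) UNIV)
        = T ^ (N - sum x UNIV) * (\<Prod>k\<in>UNIV. h k (c k))"
      unfolding t rest_def h_def by (simp add: power_mult_distrib prod.distrib prod_dividef)
  qed simp
  also have "\<dots> = T ^ (N - sum x UNIV) * (\<Prod>k\<in>UNIV. \<Sum>d\<in>states (x k). h k d)"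
    unfolding B_def by (subst prod_sum_PiE) (auto simp: sum_distrib_left)
  finally show ?thesis by (simp only: row T_def)
qed

section \<open>Linear independence of power products\<close>

text \<open>Induction on the variables: with \<open>t j\<close> as indeterminate the sum is a
  univariate polynomial with only zero values, hence zero, and its coefficient at \<open>m j\<close>
  is a relation in the other variables. The set \<open>A\<close> is arbitrary so that it can shrink
  to the exponents agreeing with \<open>m\<close> at \<open>j\<close>.\<close>

lemma power_products_independent_on:
  fixes f :: "('b \<Rightarrow> nat) \<Rightarrow> 'a::{comm_ring_1, ring_no_zero_divisors, ring_char_0}"
  assumes "finite J" "finite A" "inj_on (\<lambda>m. restrict m J) A"
    and "\<And>t. (\<Sum>m\<in>A. f m * (\<Prod>j\<in>J. t j ^ m j)) = 0" and "m \<in> A"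
  shows "f m = 0"
  using assms
proof (induction J arbitrary: A rule: finite_induct)
  case empty
  \<comment> \<open>With no variables left, injectivity of the restriction allows only one
    exponent.\<close>
  then have "A = {m}" by (auto simp: inj_on_def)
  then show ?case using empty(3) by simp
next
  case (insert j J)
  show ?case
  proof (rule insert.IH)
    show "finite {m' \<in> A. m' j = m j}" "m \<in> {m' \<in> A. m' j = m j}" using insert by auto
    show "inj_on (\<lambda>m. restrict m J) {m' \<in> A. m' j = m j}"
    proof (rule inj_onI)
      fix p q assume pq: "p \<in> {m' \<in> A. m' j = m j}" "q \<in> {m' \<in> A. m' j = m j}" "restrict p J = restrict q J"
      then have "restrict p (insert j J) = restrict q (insert j J)"
        by (auto simp: fun_eq_iff restrict_def split: if_splits)
      then show "p = q" using pq(1,2) inj_onD[OF insert.prems(2), of p q] by blast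
    qed
    fix t
    define q where "q = (\<Sum>m\<in>A. monom (f m * (\<Prod>j\<in>J. t j ^ m j)) (m j))"
    have "poly q X = 0" for X
    proof -
      have "(\<Prod>i\<in>J. (t(j := X)) i ^ p i) = (\<Prod>i\<in>J. t i ^ p i)" for p
        using insert(2) by (intro prod.cong) auto
      then show ?thesis using insert.prems(3)[of "t(j := X)"] insert(1,2)
        by (simp add: q_def poly_sum poly_monom mult_ac)
    qed
    then have "q = 0" using poly_all_0_iff_0 by blast
    then have "coeff q (m j) = 0" by simp
    moreover have "coeff q (m j) = (\<Sum>m'\<in>A. if m' j = m j then f m' * (\<Prod>j\<in>J. t j ^ m' j) else 0)"
      by (simp add: q_def coeff_sum)
    ultimately show "(\<Sum>m'\<in>{m' \<in> A. m' j = m j}. f m' * (\<Prod>j\<in>J. t j ^ m' j)) = 0"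
      using insert.prems(1) by (simp add: sum.inter_filter)
  qed
qed

lemma power_products_coeff_eq:
  fixes f g :: "('n::finite \<Rightarrow> nat) \<Rightarrow> complex"
  assumes "\<And>t. (\<Sum>m\<in>states N. f m * (\<Prod>j\<in>UNIV. t j ^ m j)) = (\<Sum>m\<in>states N. g m * (\<Prod>j\<in>UNIV. t j ^ m j))"
    and "m \<in> states N"
  shows "f m = g m"
proof -
  have "f m - g m = 0"
  proof (rule power_products_independent_on[of UNIV "states N" "\<lambda>m. f m - g m"])
    show "(\<Sum>m\<in>states N. (f m - g m) * (\<Prod>j\<in>UNIV. t j ^ m j)) = 0" for t
      using assms(1)[of t] by (simp add: left_diff_distrib sum_subtractf)
  qed (use assms(2) in \<open>auto simp: inj_on_def restrict_UNIV\<close>)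
  then show ?thesis by simp
qed

section \<open>Roots of the characteristic polynomial\<close>

text \<open>The common factor of both types: \<open>F\<close> is the diagonal matrix of \<alpha>
  minus the rank one matrix \<open>weight i (\<alpha> k) * \<beta> j\<close>, and \<open>u\<close>
  is \<open>weight i (\<alpha> k) * (r j - 1) / (r j - \<alpha> k)\<close>.\<close>

abbreviation weight :: "chain_type \<Rightarrow> real \<Rightarrow> real" where
  "weight i a \<equiv> (case i of Type1 \<Rightarrow> a | Type2 \<Rightarrow> 1)"

text \<open>A kernel vector \<open>v\<close> satisfies \<open>(l - a k) * v k = - w k * s\<close>,
  where \<open>s\<close> pairs \<open>b\<close> with \<open>v\<close>. Solving for
  \<open>v k\<close> and substituting into \<open>s\<close> gives the secular equation after
  division by \<open>s\<close>.\<close>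

lemma rank_one_perturbation_eigenvalue:
  fixes a b w :: "'n::finite \<Rightarrow> complex"
  assumes "det ((\<chi> k j. (if k = j then l - a k else 0) + w k * b j) :: complex^'n^'n) = 0"
    and "inj a" and "\<And>k. w k \<noteq> 0" and "\<And>k. b k \<noteq> 0"
  shows "l \<noteq> a k" "(\<Sum>k\<in>UNIV. b k * w k / (l - a k)) = -1"
proof -
  define A :: "complex^'n^'n" where "A = (\<chi> k j. (if k = j then l - a k else 0) + w k * b j)"
  have "det A = 0" using assms(1) by (simp add: A_def)
  then have "\<not> (\<exists>B. B ** A = mat 1)" by (simp flip: invertible_left_inverse add: invertible_det_nz)
  then obtain v where v: "A *v v = 0" "v \<noteq> 0" using matrix_left_invertible_ker[of A] by blast
  define s where "s = (\<Sum>j\<in>UNIV. b j * v $ j)"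
  have eq: "(l - a k) * v $ k + w k * s = 0" for k
  proof -
    have "(A *v v) $ k = (\<Sum>j\<in>UNIV. (if k = j then (l - a k) * v $ j else 0) + w k * (b j * v $ j))"
      unfolding matrix_vector_mult_def A_def by (auto simp: algebra_simps intro!: sum.cong)
    then show ?thesis by (simp add: v sum.distrib s_def sum_distrib_left)
  qed
  have ne: "l \<noteq> a k" for k
  \<comment> \<open>If \<open>l = a k\<close>, then \<open>s = 0\<close>; distinctness of the
    \<open>a j\<close> kills every other component of \<open>v\<close>, and
    \<open>b k * v k = s\<close> kills the last one.\<close>
  proof
    assume l: "l = a k"
    then have s: "s = 0" using eq[of k] assms(3) by simp
    have v0: "v $ j = 0" if "j \<noteq> k" for j
      using eq[of j] that s l assms(2) by (auto dest: injD)
    have "s = (\<Sum>j\<in>UNIV. if j = k then b k * v $ k else 0)"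
      unfolding s_def by (rule sum.cong) (auto simp: v0)
    then have "v $ k = 0" using s assms(4) by simp
    then have "v = 0" using v0 by (metis vec_eq_iff zero_index)
    then show False using v by simp
  qed
  then have vk: "v $ k = - (w k * s) / (l - a k)" for k
    using eq[of k] by (simp add: field_simps eq_neg_iff_add_eq_0)
  have "s \<noteq> 0" using v vk by (auto simp: vec_eq_iff)
  have "s = - s * (\<Sum>k\<in>UNIV. b k * w k / (l - a k))"
    unfolding sum_distrib_left by (subst s_def) (auto simp: vk intro!: sum.cong)
  then have "s * (1 + (\<Sum>k\<in>UNIV. b k * w k / (l - a k))) = 0" by (simp add: distrib_left eq_neg_iff_add_eq_0)
  then show "(\<Sum>k\<in>UNIV. b k * w k / (l - a k)) = -1" "l \<noteq> a k"
    using \<open>s \<noteq> 0\<close> ne by (auto simp: add_eq_0_iff)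
qed

lemma poly_det:
  fixes A :: "'a::comm_ring_1 poly^'n^'n"
  shows "poly (det A) x = det (\<chi> k j. poly (A $ k $ j) x)"
  by (simp add: det_def poly_sum poly_prod)

lemma lists_roots_poly:
  assumes "lists_roots r p"
  shows "poly p (r j) = 0"
proof -
  have "r j \<in># image_mset r (mset_set UNIV)" by simp
  then have "r j \<in># proots p" using assms by (simp only: lists_roots_def)
  then show ?thesis by (cases "p = 0") auto
qed

text \<open>Evaluated at a root, the characteristic matrix is diagonal plus rank one. The first
  conclusion makes the denominators of \<open>u\<close> nonzero.\<close>

lemma characteristic_equation:
  fixes \<alpha> \<beta> :: "'n::finite \<Rightarrow> real"
  assumes "\<And>k. 0 < \<alpha> k" and "\<And>k. 0 < \<beta> k" and "inj \<alpha>"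
    and "lists_roots r (charpoly (F i \<alpha> \<beta>))"
  shows "r j \<noteq> of_real (\<alpha> k)"
    "(\<Sum>k\<in>UNIV. of_real (\<beta> k) * of_real (weight i (\<alpha> k)) / (r j - of_real (\<alpha> k))) = -1"
proof -
  have "det ((\<chi> k l. poly ((mat [:0, 1:] - (\<chi> k j. [:complex_of_real (F i \<alpha> \<beta> $ k $ j):])) $ k $ l) (r j)) :: complex^'n^'n) = 0"
    using lists_roots_poly[OF assms(4), of j] by (simp add: charpoly_def poly_det)
  also have "(\<chi> k l. poly ((mat [:0, 1:] - (\<chi> k j. [:complex_of_real (F i \<alpha> \<beta> $ k $ j):])) $ k $ l) (r j))
    = (\<chi> k l. (if k = l then r j - of_real (\<alpha> k) else 0) + of_real (weight i (\<alpha> k)) * of_real (\<beta> l))"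
    by (cases i) (auto simp: vec_eq_iff mat_def)
  finally have det: "det ((\<chi> k l. (if k = l then r j - of_real (\<alpha> k) else 0)
    + of_real (weight i (\<alpha> k)) * of_real (\<beta> l)) :: complex^'n^'n) = 0" .
  have inj: "inj (\<lambda>k. complex_of_real (\<alpha> k))" using assms(3) by (simp add: inj_def)
  have nz: "complex_of_real (weight i (\<alpha> k)) \<noteq> 0" "complex_of_real (\<beta> k) \<noteq> 0" for k
    using assms(1,2)[of k] by (cases i; simp)+
  show "r j \<noteq> of_real (\<alpha> k)"
    "(\<Sum>k\<in>UNIV. of_real (\<beta> k) * of_real (weight i (\<alpha> k)) / (r j - of_real (\<alpha> k))) = -1"
    using rank_one_perturbation_eigenvalue[OF det inj nz] by auto
qed

section \<open>Eigenvectors\<close>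

lemma P_eigenvector:
  fixes \<alpha> \<beta> :: "'n::finite \<Rightarrow> real" and r :: "'n \<Rightarrow> complex"
  assumes "\<And>k. 0 < \<alpha> k" and "\<And>k. 0 < \<beta> k" and "inj \<alpha>"
    and "lists_roots r (charpoly (F i \<alpha> \<beta>))"
    and "m \<in> states N" and "y \<in> states N"
  shows "(\<Sum>x\<in>states N. of_real (K i x y N \<alpha> \<beta>) * P N m x (u i \<alpha> r))
    = P N m y (u i \<alpha> r) * (\<Prod>j\<in>UNIV. r j ^ m j)"
proof -
  note char = characteristic_equation[OF assms(1-4)]
  define v where "v = u i \<alpha> r"
  have v: "v k j = of_real (weight i (\<alpha> k)) * (r j - 1) / (r j - of_real (\<alpha> k))" for k j
    by (cases i) (simp_all add: v_def)
  \<comment> \<open>The secular equation, multiplied by \<open>r j - 1\<close>.\<close>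
  have v\<beta>: "1 - (\<Sum>k\<in>UNIV. of_real (\<beta> k) * v k j) = r j" for j
  proof -
    have "(\<Sum>k\<in>UNIV. of_real (\<beta> k) * v k j)
        = (r j - 1) * (\<Sum>k\<in>UNIV. of_real (\<beta> k) * of_real (weight i (\<alpha> k)) / (r j - of_real (\<alpha> k)))"
      by (simp add: v sum_distrib_left mult_ac)
    then show ?thesis by (simp add: char(2))
  qed
  \<comment> \<open>With denominators cleared, the definition of \<open>u\<close> says that
    \<open>(r j - \<alpha> k) * (1 - v k j)\<close> is \<open>1 - \<alpha> k\<close> times
    \<open>r j\<close> or 1, according to the type.\<close>
  have v\<alpha>: "of_real (\<alpha> k) * (1 - v k j) + of_real (1 - \<alpha> k) * (case i of Type1 \<Rightarrow> r j | Type2 \<Rightarrow> 1)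
      = r j * (1 - v k j)" for k j
    using char(1)[of j k] by (cases i) (simp_all add: v field_simps)
  define s where "s t k = 1 + (\<Sum>j\<in>UNIV. (1 - v k j) * t j)" for t k
  have gen: "(\<Sum>m\<in>states N. multinom N m * (\<Prod>j\<in>UNIV. t j ^ m j) * P N m x v)
      = (1 + sum t UNIV) ^ (N - sum x UNIV) * (\<Prod>k\<in>UNIV. s t k ^ x k)" if "x \<in> states N" for x t
    using P_generating_function[OF that] by (simp add: s_def)
  \<comment> \<open>This is the form \<open>b\<close> of \<open>K_transform\<close> at
    \<open>s0 = 1 + |t|\<close>: it becomes \<open>s0\<close> with each \<open>t j\<close> scaled by
    \<open>r j\<close>. The next fact does the same for the other linear forms.\<close>
  have s\<beta>: "of_real (1 - sum \<beta> UNIV) * (1 + sum t UNIV) + (\<Sum>k\<in>UNIV. of_real (\<beta> k) * s t k)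
      = 1 + (\<Sum>j\<in>UNIV. r j * t j)" for t
  proof -
    have "(\<Sum>k\<in>UNIV. of_real (\<beta> k) * s t k)
        = of_real (sum \<beta> UNIV) * (1 + sum t UNIV) - (\<Sum>k\<in>UNIV. \<Sum>j\<in>UNIV. of_real (\<beta> k) * v k j * t j)"
      by (simp add: s_def algebra_simps sum.distrib sum_subtractf sum_distrib_left sum_distrib_right)
    also have "(\<Sum>k\<in>UNIV. \<Sum>j\<in>UNIV. of_real (\<beta> k) * v k j * t j)
        = (\<Sum>j\<in>UNIV. (1 - r j) * t j)"
      by (subst sum.swap) (simp add: sum_distrib_right[symmetric] flip: v\<beta>)
    finally show ?thesis by (simp add: algebra_simps sum_subtractf)
  qed
  have s\<alpha>: "of_real (\<alpha> k) * s t k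
      + of_real (1 - \<alpha> k) * (case i of Type1 \<Rightarrow> 1 + (\<Sum>j\<in>UNIV. r j * t j) | Type2 \<Rightarrow> 1 + sum t UNIV)
      = s (\<lambda>j. r j * t j) k" for k t
  proof -
    have "(case i of Type1 \<Rightarrow> 1 + (\<Sum>j\<in>UNIV. r j * t j) | Type2 \<Rightarrow> 1 + sum t UNIV)
        = 1 + (\<Sum>j\<in>UNIV. (case i of Type1 \<Rightarrow> r j | Type2 \<Rightarrow> 1) * t j)"
      by (cases i) simp_all
    then have "of_real (\<alpha> k) * s t k
      + of_real (1 - \<alpha> k) * (case i of Type1 \<Rightarrow> 1 + (\<Sum>j\<in>UNIV. r j * t j) | Type2 \<Rightarrow> 1 + sum t UNIV)
      = 1 + (\<Sum>j\<in>UNIV. (of_real (\<alpha> k) * (1 - v k j) + of_real (1 - \<alpha> k) * (case i of Type1 \<Rightarrow> r j | Type2 \<Rightarrow> 1)) * t j)"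
      unfolding s_def by (simp add: distrib_left distrib_right sum.distrib sum_distrib_left mult.assoc del: of_real_diff)
        (simp add: algebra_simps)
    then show ?thesis unfolding v\<alpha> by (simp add: s_def mult_ac)
  qed
  \<comment> \<open>The nonzero factor \<open>multinom N m\<close> turns both sides into
    coefficients of generating functions.\<close>
  have "multinom N m * (\<Sum>x\<in>states N. of_real (K i x y N \<alpha> \<beta>) * P N m x v)
      = multinom N m * ((\<Prod>j\<in>UNIV. r j ^ m j) * P N m y v)"
  proof (rule power_products_coeff_eq[where N = N and m = m])
    fix t :: "'n \<Rightarrow> complex"
    have "(\<Sum>m\<in>states N. multinom N m * (\<Sum>x\<in>states N. of_real (K i x y N \<alpha> \<beta>) * P N m x v) * (\<Prod>j\<in>UNIV. t j ^ m j))
      = (\<Sum>x\<in>states N. of_real (K i x y N \<alpha> \<beta>) * (\<Sum>m\<in>states N. multinom N m * (\<Prod>j\<in>UNIV. t j ^ m j) * P N m x v))"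
      unfolding sum_distrib_left sum_distrib_right by (subst sum.swap) (simp only: mult_ac)
    also have "\<dots> = (1 + (\<Sum>j\<in>UNIV. r j * t j)) ^ (N - sum y UNIV) * (\<Prod>k\<in>UNIV. s (\<lambda>j. r j * t j) k ^ y k)"
      using K_transform[OF assms(6), where \<alpha> = \<alpha> and \<beta> = \<beta> and i = i and s = "s t" and ?s0.0 = "1 + sum t UNIV"]
      by (simp only: gen s\<beta> s\<alpha> cong: sum.cong)
    also have "\<dots> = (\<Sum>m\<in>states N. multinom N m * (\<Prod>j\<in>UNIV. (r j * t j) ^ m j) * P N m y v)"
      using gen[OF assms(6)] by simp
    finally show "(\<Sum>m\<in>states N. multinom N m * (\<Sum>x\<in>states N. of_real (K i x y N \<alpha> \<beta>) * P N m x v) * (\<Prod>j\<in>UNIV. t j ^ m j))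
      = (\<Sum>m\<in>states N. multinom N m * ((\<Prod>j\<in>UNIV. r j ^ m j) * P N m y v) * (\<Prod>j\<in>UNIV. t j ^ m j))"
      by (simp add: power_mult_distrib prod.distrib mult_ac)
  qed fact
  then show ?thesis by (simp add: multinom_nonzero v_def mult_ac)
qed

text \<open>At the origin the generating function is \<open>(1 + |t|) ^ N\<close>, whose
  coefficients are the multinomial ones. This shows that the eigenvectors do not vanish
  identically.\<close>

lemma P_zero:
  assumes "m \<in> states N"
  shows "P N m (\<lambda>_. 0) v = 1"
proof -
  have "multinom N m * P N m (\<lambda>_. 0) v = multinom N m"
  proof (rule power_products_coeff_eq[where N = N and m = m])
    fix t :: "'a \<Rightarrow> complex"
    have "(\<Sum>m\<in>states N. multinom N m * P N m (\<lambda>_. 0) v * (\<Prod>j\<in>UNIV. t j ^ m j)) = (1 + sum t UNIV) ^ N"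
      using P_generating_function[of "\<lambda>_. 0" N t v] by (simp add: states_def mult_ac)
    also have "\<dots> = (\<Sum>m\<in>states N. multinom N m * (\<Prod>j\<in>UNIV. t j ^ m j))"
      using multinomial_theorem[of N 1 t] by simp
    finally show "(\<Sum>m\<in>states N. multinom N m * P N m (\<lambda>_. 0) v * (\<Prod>j\<in>UNIV. t j ^ m j))
      = (\<Sum>m\<in>states N. multinom N m * (\<Prod>j\<in>UNIV. t j ^ m j))" .
  qed fact
  then show ?thesis by (simp add: multinom_nonzero)
qed

section \<open>Detailed balance\<close>

lemma D_pos:
  assumes "\<And>k. 0 < \<alpha> k \<and> \<alpha> k < 1" and "\<And>k. 0 < \<beta> k"
  shows "0 < D i \<alpha> \<beta>"
proof -
  have "0 \<le> (\<Sum>l\<in>UNIV. \<alpha> l * \<beta> l / (1 - \<alpha> l))" "0 \<le> (\<Sum>l\<in>UNIV. \<beta> l / (1 - \<alpha> l))"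
    using assms by (auto intro!: sum_nonneg simp: less_imp_le)
  then show ?thesis by (cases i) simp_all
qed

text \<open>The equilibrium probability of category 0; it rests on \<open>\<alpha> k * \<beta> k /
  (1 - \<alpha> k) = \<beta> k / (1 - \<alpha> k) - \<beta> k\<close>.\<close>

lemma one_minus_sum_\<eta>:
  assumes "\<And>k. 0 < \<alpha> k \<and> \<alpha> k < 1" and "\<And>k. 0 < \<beta> k"
  shows "1 - sum (\<eta> i \<alpha> \<beta>) UNIV = (case i of Type1 \<Rightarrow> 1 - sum \<beta> UNIV | Type2 \<Rightarrow> 1) / D i \<alpha> \<beta>"
proof -
  have "\<alpha> k * \<beta> k / (1 - \<alpha> k) = \<beta> k / (1 - \<alpha> k) - \<beta> k" for k
    using assms(1)[of k] by (simp add: field_simps)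
  then have "D i \<alpha> \<beta> - (\<Sum>k\<in>UNIV. \<beta> k / (1 - \<alpha> k)) = (case i of Type1 \<Rightarrow> 1 - sum \<beta> UNIV | Type2 \<Rightarrow> 1)"
    by (cases i) (simp_all add: sum_subtractf)
  moreover have "sum (\<eta> i \<alpha> \<beta>) UNIV = (\<Sum>k\<in>UNIV. \<beta> k / (1 - \<alpha> k)) / D i \<alpha> \<beta>"
    by (simp add: \<eta>_def sum_divide_distrib)
  ultimately show ?thesis
    using D_pos[of \<alpha> \<beta> i, OF assms] by (simp add: eq_divide_eq left_diff_distrib)
qed

text \<open>In this form the joint law of a state \<open>y\<close> at equilibrium and its thinning \<open>z\<close> shows the
  symmetry behind detailed balance: the factor \<open>1 / \<Prod>k. fact (y k)\<close> of \<open>Wn\<close> cancels.\<close>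

lemma thinning_Wn_\<eta>:
  assumes "\<And>k. 0 < \<alpha> k \<and> \<alpha> k < 1" and "\<And>k. 0 < \<beta> k" and "y \<in> states N"
  shows "(\<Prod>k\<in>UNIV. W1 (z k) (y k) (\<alpha> k)) * Wn (\<lambda>k. int (y k)) N (\<eta> i \<alpha> \<beta>) =
    (if \<forall>k. z k \<le> y k
     then fact N / fact (N - sum y UNIV) * (case i of Type1 \<Rightarrow> 1 - sum \<beta> UNIV | Type2 \<Rightarrow> 1) ^ (N - sum y UNIV)
       / D i \<alpha> \<beta> ^ N * (\<Prod>k\<in>UNIV. (\<beta> k * \<alpha> k / (1 - \<alpha> k)) ^ z k / fact (z k))
       * (\<Prod>k\<in>UNIV. \<beta> k ^ (y k - z k) / fact (y k - z k))
     else 0)"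
proof (cases "\<forall>k. z k \<le> y k")
  case True
  define d where "d = D i \<alpha> \<beta>"
  have y: "sum y UNIV \<le> N" using assms(3) by (simp add: states_def)
  have eq: "W1 (z k) (y k) (\<alpha> k) * (\<eta> i \<alpha> \<beta> k ^ y k / fact (y k))
    = ((\<beta> k * \<alpha> k / (1 - \<alpha> k)) ^ z k / fact (z k)) * (\<beta> k ^ (y k - z k) / fact (y k - z k)) / d ^ y k" for k
  proof -
    have "1 - \<alpha> k \<noteq> 0" using assms(1)[of k] by simp
    moreover have "\<eta> i \<alpha> \<beta> k ^ y k = (\<beta> k / (1 - \<alpha> k)) ^ z k * (\<beta> k / (1 - \<alpha> k)) ^ (y k - z k) / d ^ y k"
      using True by (simp add: \<eta>_def d_def power_mult_distrib power_divide flip: power_add)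
    ultimately show ?thesis using True
      by (simp add: W1_def binomial_fact power_divide power_mult_distrib mult_ac)
  qed
  have "(\<Prod>k\<in>UNIV. W1 (z k) (y k) (\<alpha> k)) * Wn (\<lambda>k. int (y k)) N (\<eta> i \<alpha> \<beta>)
    = fact N / fact (N - sum y UNIV) * (1 - sum (\<eta> i \<alpha> \<beta>) UNIV) ^ (N - sum y UNIV)
      * (\<Prod>k\<in>UNIV. W1 (z k) (y k) (\<alpha> k) * (\<eta> i \<alpha> \<beta> k ^ y k / fact (y k)))"
    using y by (simp add: Wn_nat multinom_def prod.distrib prod_dividef mult_ac)
  also have "\<dots> = fact N / fact (N - sum y UNIV) * (1 - sum (\<eta> i \<alpha> \<beta>) UNIV) ^ (N - sum y UNIV) / d ^ sum y UNIV
       * (\<Prod>k\<in>UNIV. (\<beta> k * \<alpha> k / (1 - \<alpha> k)) ^ z k / fact (z k))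
       * (\<Prod>k\<in>UNIV. \<beta> k ^ (y k - z k) / fact (y k - z k))"
    unfolding eq by (simp add: prod.distrib prod_dividef power_sum mult_ac)
  also have "(1 - sum (\<eta> i \<alpha> \<beta>) UNIV) ^ (N - sum y UNIV)
     = (case i of Type1 \<Rightarrow> 1 - sum \<beta> UNIV | Type2 \<Rightarrow> 1) ^ (N - sum y UNIV) / d ^ (N - sum y UNIV)"
    unfolding one_minus_sum_\<eta>[OF assms(1,2)] d_def power_divide ..
  \<comment> \<open>The powers of \<open>D\<close> from category 0 and from the other categories
    combine to one independent of \<open>y\<close>.\<close>
  also have "d ^ N = d ^ (N - sum y UNIV) * d ^ sum y UNIV" using y by (simp flip: power_add)
  then have "fact N / fact (N - sum y UNIV)
     * ((case i of Type1 \<Rightarrow> 1 - sum \<beta> UNIV | Type2 \<Rightarrow> 1) ^ (N - sum y UNIV) / d ^ (N - sum y UNIV)) / d ^ sum y UNIV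
     = fact N / fact (N - sum y UNIV)
     * (case i of Type1 \<Rightarrow> 1 - sum \<beta> UNIV | Type2 \<Rightarrow> 1) ^ (N - sum y UNIV) / d ^ N" by simp
  finally show ?thesis using True by (simp add: d_def)
next
  case False
  then show ?thesis by (auto simp: prod_W1_eq_0)
qed

lemma detailed_balance:
  fixes \<alpha> \<beta> :: "'n::finite \<Rightarrow> real"
  assumes "\<And>k. 0 < \<alpha> k \<and> \<alpha> k < 1" and "\<And>k. 0 < \<beta> k" and "x \<in> states N" and "y \<in> states N"
  shows "K i x y N \<alpha> \<beta> * Wn (\<lambda>k. int (y k)) N (\<eta> i \<alpha> \<beta>) = K i y x N \<alpha> \<beta> * Wn (\<lambda>k. int (x k)) N (\<eta> i \<alpha> \<beta>)"
proof -
  define M where "M y z = (case i of Type1 \<Rightarrow> N - sum z UNIV | Type2 \<Rightarrow> N - sum y UNIV)" for y z :: "'n \<Rightarrow> nat"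
  define E where "E x y z = Wn (\<lambda>k. int (x k) - int (z k)) (M y z) \<beta>
      * ((\<Prod>k\<in>UNIV. W1 (z k) (y k) (\<alpha> k)) * Wn (\<lambda>k. int (y k)) N (\<eta> i \<alpha> \<beta>))" for x y z
  have K: "K i x y N \<alpha> \<beta> * Wn (\<lambda>k. int (y k)) N (\<eta> i \<alpha> \<beta>) = (\<Sum>z\<in>states N. E x y z)" for x y
    by (cases i) (simp_all add: M_def E_def sum_distrib_right mult.assoc)
  define T where "T x z = (\<Prod>k\<in>UNIV. \<beta> k ^ (x k - z k) / fact (x k - z k))" for x z :: "'n \<Rightarrow> nat"
  define R where "R z = fact N / D i \<alpha> \<beta> ^ N * (\<Prod>k\<in>UNIV. (\<beta> k * \<alpha> k / (1 - \<alpha> k)) ^ z k / fact (z k))" for z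
  \<comment> \<open>The equilibrium weight of the path from \<open>y\<close> through
    \<open>z\<close> to \<open>x\<close>, in a form symmetric in \<open>x\<close> and
    \<open>y\<close>. In type 2 the factor \<open>fact (N - |y|)\<close> has cancelled, and the
    guard says that the \<open>|x| - |z|\<close> newly placed individuals number at most
    \<open>N - |y|\<close>.\<close>
  define Q where "Q x y z = (if (\<forall>k. z k \<le> x k) \<and> (\<forall>k. z k \<le> y k) then
      (case i of Type1 \<Rightarrow> fact (N - sum z UNIV) / (fact (N - sum x UNIV) * fact (N - sum y UNIV))
          * (1 - sum \<beta> UNIV) ^ (N - sum x UNIV) * (1 - sum \<beta> UNIV) ^ (N - sum y UNIV)
        | Type2 \<Rightarrow> if sum x UNIV + sum y UNIV \<le> N + sum z UNIV
          then (1 - sum \<beta> UNIV) ^ (N + sum z UNIV - (sum x UNIV + sum y UNIV))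
            / fact (N + sum z UNIV - (sum x UNIV + sum y UNIV)) else 0)
      * R z * (T x z * T y z) else 0)" for x y z :: "'n \<Rightarrow> nat"
  have E: "E x y z = Q x y z" if xy: "x \<in> states N" "y \<in> states N" for x y z
  proof (cases "(\<forall>k. z k \<le> x k) \<and> (\<forall>k. z k \<le> y k)")
    case True
    have sums: "(\<Sum>k\<in>UNIV. x k - z k) = sum x UNIV - sum z UNIV" "sum z UNIV \<le> sum x UNIV"
      "sum z UNIV \<le> sum y UNIV" "sum x UNIV \<le> N" "sum y UNIV \<le> N"
      using True xy sum_diff_nat_fun[of z x] sum_diff_nat_fun[of z y] by (auto simp: states_def)
    have Wn: "Wn (\<lambda>k. int (x k) - int (z k)) (M y z) \<beta> =
      (if sum x UNIV - sum z UNIV \<le> M y z then fact (M y z) / fact (M y z - (sum x UNIV - sum z UNIV))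
         * (1 - sum \<beta> UNIV) ^ (M y z - (sum x UNIV - sum z UNIV)) * T x z else 0)"
      using True by (simp add: Wn_diff sums(1) multinom_def T_def prod_dividef mult_ac)
    show ?thesis
    proof (cases i)
      case Type1
      have "N - sum z UNIV - (sum x UNIV - sum z UNIV) = N - sum x UNIV" using sums by linarith
      then show ?thesis using True sums
        unfolding E_def Wn thinning_Wn_\<eta>[OF assms(1,2) xy(2)] Q_def T_def[symmetric]
        by (simp add: Type1 M_def R_def diff_le_mono mult_ac del: diff_diff_left D.simps)
    next
      case Type2
      have "N - sum y UNIV - (sum x UNIV - sum z UNIV) = N + sum z UNIV - (sum x UNIV + sum y UNIV)"
        "sum x UNIV - sum z UNIV \<le> N - sum y UNIV \<longleftrightarrow> sum x UNIV + sum y UNIV \<le> N + sum z UNIV"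
        using sums by linarith+
      then show ?thesis using True
        unfolding E_def Wn thinning_Wn_\<eta>[OF assms(1,2) xy(2)] Q_def T_def[symmetric]
        by (simp add: Type2 M_def R_def mult_ac del: diff_diff_left D.simps)
    qed
  next
    case False
    then show ?thesis
      unfolding E_def thinning_Wn_\<eta>[OF assms(1,2) xy(2)] Q_def by (auto simp: Wn_diff)
  qed
  have "Q x y z = Q y x z" for z by (auto simp: Q_def add.commute mult_ac split: chain_type.splits)
  then show ?thesis unfolding K by (simp add: E assms(3,4))
qed

section \<open>Nonvanishing of the eigenvectors and both eigenvalue equations\<close>

theorem theorem3p9:
  fixes \<alpha> \<beta> :: "'n::finite \<Rightarrow> real" and r :: "'n \<Rightarrow> complex"
    and N :: nat and i :: chain_type and m :: "'n \<Rightarrow> nat"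
  assumes "N \<ge> 1"
    and "\<And>k. 0 < \<alpha> k \<and> \<alpha> k < 1"
    and "\<And>k. 0 < \<beta> k \<and> \<beta> k < 1"
    and "0 < (\<Sum>k\<in>UNIV. \<beta> k)" and "(\<Sum>k\<in>UNIV. \<beta> k) < 1"
    and "inj \<alpha>"
    and "lists_roots r (charpoly (F i \<alpha> \<beta>))"
    and "m \<in> states N"
  shows "(\<exists>x\<in>states N. P N m x (u i \<alpha> r) \<noteq> 0)
       \<and> (\<forall>y\<in>states N.
            (\<Sum>x\<in>states N. of_real (K i x y N \<alpha> \<beta>) * P N m x (u i \<alpha> r))
            = P N m y (u i \<alpha> r) * (\<Prod>j\<in>UNIV. r j ^ m j))
       \<and> (\<exists>x\<in>states N. P N m x (u i \<alpha> r) * of_real (Wn (\<lambda>k. int (x k)) N (\<eta> i \<alpha> \<beta>)) \<noteq> 0)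
       \<and> (\<forall>x\<in>states N.
            (\<Sum>y\<in>states N. of_real (K i x y N \<alpha> \<beta>)
               * (P N m y (u i \<alpha> r) * of_real (Wn (\<lambda>k. int (y k)) N (\<eta> i \<alpha> \<beta>))))
            = (\<Prod>j\<in>UNIV. r j ^ m j)
               * (P N m x (u i \<alpha> r) * of_real (Wn (\<lambda>k. int (x k)) N (\<eta> i \<alpha> \<beta>))))"
proof (intro conjI ballI)
  have pos: "\<And>k. 0 < \<alpha> k" "\<And>k. 0 < \<beta> k" using assms(2,3) by auto
  have zero: "(\<lambda>_. 0) \<in> states N" by (simp add: states_def)
  show "\<exists>x\<in>states N. P N m x (u i \<alpha> r) \<noteq> 0"
    using zero P_zero[OF assms(8)] by (metis zero_neq_one)
  \<comment> \<open>At the origin \<open>Wn\<close> is the \<open>N\<close>-th power of this number,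
    so the weighted eigenvector is nonzero there too.\<close>
  have "1 - sum (\<eta> i \<alpha> \<beta>) UNIV \<noteq> 0"
    unfolding one_minus_sum_\<eta>[OF assms(2) pos(2)]
    using D_pos[of \<alpha> \<beta> i, OF assms(2) pos(2)] assms(5) by (cases i) (auto simp del: D.simps)
  then have "Wn (\<lambda>k. int 0) N (\<eta> i \<alpha> \<beta>) \<noteq> 0"
    by (simp add: Wn_def)
  then show "\<exists>x\<in>states N. P N m x (u i \<alpha> r) * of_real (Wn (\<lambda>k. int (x k)) N (\<eta> i \<alpha> \<beta>)) \<noteq> 0"
    using P_zero[OF assms(8), of "u i \<alpha> r"] by (intro bexI[OF _ zero]) simp
  note left = P_eigenvector[OF pos assms(6-8)]
  show "(\<Sum>x\<in>states N. of_real (K i x y N \<alpha> \<beta>) * P N m x (u i \<alpha> r))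
      = P N m y (u i \<alpha> r) * (\<Prod>j\<in>UNIV. r j ^ m j)" if "y \<in> states N" for y
    using that by (rule left)
  show "(\<Sum>y\<in>states N. of_real (K i x y N \<alpha> \<beta>)
      * (P N m y (u i \<alpha> r) * of_real (Wn (\<lambda>k. int (y k)) N (\<eta> i \<alpha> \<beta>))))
      = (\<Prod>j\<in>UNIV. r j ^ m j) * (P N m x (u i \<alpha> r) * of_real (Wn (\<lambda>k. int (x k)) N (\<eta> i \<alpha> \<beta>)))"
    if x: "x \<in> states N" for x
  proof -
    \<comment> \<open>Detailed balance transposes the kernel and pulls out the weight at
      \<open>x\<close>, leaving the first eigenvalue equation at \<open>x\<close>.\<close>
    have "(\<Sum>y\<in>states N. of_real (K i x y N \<alpha> \<beta>)
        * (P N m y (u i \<alpha> r) * of_real (Wn (\<lambda>k. int (y k)) N (\<eta> i \<alpha> \<beta>))))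
      = (\<Sum>y\<in>states N. of_real (K i x y N \<alpha> \<beta> * Wn (\<lambda>k. int (y k)) N (\<eta> i \<alpha> \<beta>)) * P N m y (u i \<alpha> r))"
      by (simp only: of_real_mult mult_ac)
    also have "\<dots> = of_real (Wn (\<lambda>k. int (x k)) N (\<eta> i \<alpha> \<beta>))
        * (\<Sum>y\<in>states N. of_real (K i y x N \<alpha> \<beta>) * P N m y (u i \<alpha> r))"
      unfolding sum_distrib_left
      by (intro sum.cong) (simp_all only: detailed_balance[OF assms(2) pos(2) x] of_real_mult mult_ac)
    finally show ?thesis unfolding left[OF x] by (simp only: mult_ac)
  qed
qed

end
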